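(* Let $c>0$ be any constant and suppose the cost of a feasible solution of the MAMP problem with simultaneous arrival is $J=c\,t_f$. Let $\mathcal{A}$ be an algorithm that is optimal for the backward MAMP problem with cost $\tilde J=\max_i \tilde J_i$, where $\tilde J_i=c\,t_{f,i}$. Then the simultaneous-arrival algorithm $\mathrm{SA}(\mathcal{A})$ (all defined in the context) is optimal: for instances in which all agents are at rest at their initial states, the solution it returns minimizes $J$ among all feasible solutions of the MAMP problem with simultaneous arrival.
   Context: **Instance.** There are $K\ge 1$ agents in a workspace $W\subset\mathbb{R}^2$ with obstacle region $O\subset W$. Agent $i$ has dynamics $\dot x_i(t)=f_i(x_i(t),u_i(t))$, control set $\mathcal{U}_i\subset\mathbb{R}^{m_i}$, and occupies the region $R_i(x_i)\subset\mathbb{R}^2$ when in state $x_i\in\mathbb{R}^{n_i}$. Its state space is $\mathcal{X}_i=\{x_i\in\mathbb{R}^{n_i} : R_i(x_i)\subset W\}$ and its free space is $\mathcal{X}_{i,\mathrm{free}}=\{x_i\in\mathcal{X}_i : R_i(x_i)\cap O=\emptyset\}$. Each agent has an initial state $x_{s,i}$ and a final state $x_{f,i}$. All agents are at rest at their initial states: $\mathbf 0\in\mathcal{U}_i$ and $f_i(x_{s,i},\mathbf 0)=0$, so agent $i$ can remain ("wait") at $x_{s,i}$ with control $\mathbf 0$ for any duration. **Motion primitives.** A set $\mathcal{P}$ of feasible motion primitives is given for each agent: each primitive is a pair $(x,u)$ of functions on an interval $[0,t_p]$ satisfying the agent's dynamics with controls in $\mathcal{U}_i$ (all translated copies that may be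 used are included in the set). An admissible forward trajectory of agent $i$ of duration $T\ge 0$ is a wait at $x_{s,i}$ of some duration $\tau\ge0$ followed by a finite (possibly empty) concatenation of primitives with matching endpoint states, of total duration $T$. **MAMP problem with simultaneous arrival.** A feasible solution consists of a common final time $t_f\ge 0$ and, for each $i$, an admissible forward trajectory $(x_i,u_i)$ on $[0,t_f]$ with $x_i(0)=x_{s,i}$, $x_i(t_f)=x_{f,i}$, $x_i(t)\in\mathcal{X}_{i,\mathrm{free}}$ for all $t\in[0,t_f]$, and $R_i(x_i(t))\cap R_j(x_j(t))=\emptyset$ for all $i\ne j$ and $t\in[0,t_f]$. The optimal problem is to minimize the cost $J$ over feasible solutions. **Backward MAMP problem.** Here the initial states are $x_{f,i}$, the final states are $x_{s,i}$, and the primitives are the time reversals of the primitives in $\mathcal{P}$. A feasible solution consists, for each $i$, of a duration $t_{f,i}\ge0$ (not necessarily equal for different agents) and a pair $(x_{\mathrm{rev},i},u_{\mathrm{rev},i})$ on $[0,t_{f,i}]$ that is the time reversal $t\mapsto (x_i(t_{f,i}-t),u_i(t_{f,i}-t))$ of an admissible forward trajectory of duration $t_{f,i}$, with $x_{\mathrm{rev},i}(0)=x_{f,i}$, $x_{\mathrm{rev},i}(t_{f,i})=x_{s,i}$ and $x_{\mathrm{rev},i}(t)\in\mathcal{X}_{i,\mathrm{free}}$. After time $t_{f,i}$ agent $i$ remains at $x_{s,i}$, i.e. $x_{\mathrm{rev},i}(t)=x_{s,i}$ for $t>t_{f,i}$, and with this extension $R_i(x_{\mathrm{rev},i}(t))\cap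 R_j(x_{\mathrm{rev},j}(t))=\emptyset$ for all $i\neq j$ and all $t\ge0$. **Optimal algorithm.** $\mathcal{A}$ is optimal for the backward problem with cost $\tilde J$ if the solution it returns is a feasible solution of the backward problem minimizing $\tilde J$ among all feasible solutions of the backward problem. **Algorithm $\mathrm{SA}(\mathcal{A})$.** Given an instance: (1) run $\mathcal{A}$ on the backward MAMP problem to obtain $\{(x_{\mathrm{rev},i},u_{\mathrm{rev},i},t_{f,i})\}_{i=1}^K$; (2) set $t_f=\max_i t_{f,i}$; (3) for each $i$ and $t\in[0,t_f]$, set $x_i(t)=x_{\mathrm{rev},i}(t_f-t)$ and $u_i(t)=u_{\mathrm{rev},i}(t_f-t)$ if $t\ge t_f-t_{f,i}$, and $x_i(t)=x_{s,i}$, $u_i(t)=\mathbf 0$ otherwise; (4) return $(x_i,u_i)_{i=1}^K$ and $t_f$. *)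

theory Defs
  imports "HOL-Analysis.Analysis" "Jordan_Normal_Form.Matrix"
begin

(* The dimensions of state and control differ from agent to agent, so states and controls are
   vectors of type real Matrix.vec, constrained by carrier_vec; only the plane is real^2. *)

no_notation vec_nth (infixl \<open>$\<close> 90)

type_synonym rvec = "real Matrix.vec"

(* A state function and a control function on the interval [0, duration].  Both are total in HOL;
   their values outside this interval carry no meaning. *)
record motion =
  duration :: real
  state :: "real \<Rightarrow> rvec"
  ctrl :: "real \<Rightarrow> rvec"

(* The agents are the indices i < num_agents. *)
record mamp =
  num_agents :: nat
  workspace :: "(real^2) set"
  obstacles :: "(real^2) set"
  state_dim :: "nat \<Rightarrow> nat"
  ctrl_dim :: "nat \<Rightarrow> nat"
  dyn :: "nat \<Rightarrow> rvec \<Rightarrow> rvec \<Rightarrow> rvec"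
  controls :: "nat \<Rightarrow> rvec set"
  region :: "nat \<Rightarrow> rvec \<Rightarrow> (real^2) set"
  init_state :: "nat \<Rightarrow> rvec"
  final_state :: "nat \<Rightarrow> rvec"
  primitives :: "nat \<Rightarrow> motion set"

definition state_space :: "mamp \<Rightarrow> nat \<Rightarrow> rvec set" where
  "state_space I i = {x \<in> carrier_vec (state_dim I i). region I i x \<subseteq> workspace I}"

definition free_space :: "mamp \<Rightarrow> nat \<Rightarrow> rvec set" where
  "free_space I i = {x \<in> state_space I i. region I i x \<inter> obstacles I = {}}"

(* The differential equation is written componentwise; the derivatives are one-sided at the ends
   of the interval. *)
definition satisfies_dynamics :: "mamp \<Rightarrow> nat \<Rightarrow> motion \<Rightarrow> bool" where
  "satisfies_dynamics I i p \<longleftrightarrow>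
     (\<forall>t\<in>{0..duration p}.
        state p t \<in> carrier_vec (state_dim I i) \<and> ctrl p t \<in> controls I i \<and>
        (\<forall>k<state_dim I i.
           ((\<lambda>s. state p s $ k) has_real_derivative (dyn I i (state p t) (ctrl p t) $ k))
             (at t within {0..duration p})))"

definition valid_instance :: "mamp \<Rightarrow> bool" where
  "valid_instance I \<longleftrightarrow>
     num_agents I \<ge> 1 \<and>
     obstacles I \<subseteq> workspace I \<and>
     (\<forall>i<num_agents I.
        controls I i \<subseteq> carrier_vec (ctrl_dim I i) \<and>
        (\<forall>x\<in>carrier_vec (state_dim I i). \<forall>u\<in>controls I i.
           dyn I i x u \<in> carrier_vec (state_dim I i)) \<and>
        init_state I i \<in> carrier_vec (state_dim I i) \<and>
        final_state I i \<in> carrier_vec (state_dim I i) \<and>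
        (\<forall>p\<in>primitives I i. duration p \<ge> 0 \<and> satisfies_dynamics I i p))"

definition at_rest :: "mamp \<Rightarrow> bool" where
  "at_rest I \<longleftrightarrow>
     (\<forall>i<num_agents I.
        0\<^sub>v (ctrl_dim I i) \<in> controls I i \<and>
        dyn I i (init_state I i) (0\<^sub>v (ctrl_dim I i)) = 0\<^sub>v (state_dim I i))"


definition wait :: "mamp \<Rightarrow> nat \<Rightarrow> real \<Rightarrow> motion" where
  "wait I i \<tau> = \<lparr>duration = \<tau>, state = (\<lambda>t. init_state I i), ctrl = (\<lambda>t. 0\<^sub>v (ctrl_dim I i))\<rparr>"

(* At the junction time the second motion determines the control; for the state this choice is
   immaterial, as only motions with matching endpoint states are concatenated. *)
definition motion_append :: "motion \<Rightarrow> motion \<Rightarrow> motion" where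
  "motion_append p q =
     \<lparr>duration = duration p + duration q,
      state = (\<lambda>t. if t < duration p then state p t else state q (t - duration p)),
      ctrl = (\<lambda>t. if t < duration p then ctrl p t else ctrl q (t - duration p))\<rparr>"

definition matching :: "motion \<Rightarrow> motion \<Rightarrow> bool" where
  "matching p q \<longleftrightarrow> state p (duration p) = state q 0"

definition same_motion :: "motion \<Rightarrow> motion \<Rightarrow> bool" where
  "same_motion p q \<longleftrightarrow>
     duration p = duration q \<and>
     (\<forall>t\<in>{0..duration p}. state p t = state q t \<and> ctrl p t = ctrl q t)"

definition admissible :: "mamp \<Rightarrow> nat \<Rightarrow> motion \<Rightarrow> bool" where
  "admissible I i m \<longleftrightarrow>
     (\<exists>\<tau>\<ge>0. \<exists>ps. set ps \<subseteq> primitives I i \<and>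
        successively matching (wait I i \<tau> # ps) \<and>
        same_motion m (foldl motion_append (wait I i \<tau>) ps))"

definition time_reversal :: "motion \<Rightarrow> motion" where
  "time_reversal m =
     \<lparr>duration = duration m,
      state = (\<lambda>t. state m (duration m - t)),
      ctrl = (\<lambda>t. ctrl m (duration m - t))\<rparr>"


record sim_solution =
  final_time :: real
  agent_state :: "nat \<Rightarrow> real \<Rightarrow> rvec"
  agent_ctrl :: "nat \<Rightarrow> real \<Rightarrow> rvec"

definition sim_feasible :: "mamp \<Rightarrow> sim_solution \<Rightarrow> bool" where
  "sim_feasible I s \<longleftrightarrow>
     final_time s \<ge> 0 \<and>
     (\<forall>i<num_agents I.
        admissible I i
          \<lparr>duration = final_time s, state = agent_state s i, ctrl = agent_ctrl s i\<rparr> \<and>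
        agent_state s i 0 = init_state I i \<and>
        agent_state s i (final_time s) = final_state I i \<and>
        (\<forall>t\<in>{0..final_time s}. agent_state s i t \<in> free_space I i)) \<and>
     (\<forall>i<num_agents I. \<forall>j<num_agents I. i \<noteq> j \<longrightarrow>
        (\<forall>t\<in>{0..final_time s}.
           region I i (agent_state s i t) \<inter> region I j (agent_state s j t) = {}))"

definition sim_cost :: "real \<Rightarrow> mamp \<Rightarrow> sim_solution \<Rightarrow> real" where
  "sim_cost c I s = c * final_time s"


type_synonym backward_solution = "nat \<Rightarrow> motion"

definition extended_state :: "mamp \<Rightarrow> nat \<Rightarrow> motion \<Rightarrow> real \<Rightarrow> rvec" where
  "extended_state I i m t = (if t \<le> duration m then state m t else init_state I i)"

definition backward_feasible :: "mamp \<Rightarrow> backward_solution \<Rightarrow> bool" where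
  "backward_feasible I r \<longleftrightarrow>
     (\<forall>i<num_agents I.
        duration (r i) \<ge> 0 \<and>
        (\<exists>m. admissible I i m \<and> same_motion (r i) (time_reversal m)) \<and>
        state (r i) 0 = final_state I i \<and>
        state (r i) (duration (r i)) = init_state I i \<and>
        (\<forall>t\<in>{0..duration (r i)}. state (r i) t \<in> free_space I i)) \<and>
     (\<forall>i<num_agents I. \<forall>j<num_agents I. i \<noteq> j \<longrightarrow>
        (\<forall>t\<ge>0. region I i (extended_state I i (r i) t) \<inter>
               region I j (extended_state I j (r j) t) = {}))"

definition backward_cost :: "real \<Rightarrow> mamp \<Rightarrow> backward_solution \<Rightarrow> real" where
  "backward_cost c I r = (MAX i\<in>{..<num_agents I}. c * duration (r i))"


(* An algorithm either returns a solution or reports, by None, that it has none to return.  It is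
   optimal on a class of instances if every solution it returns there is a feasible one of minimal
   cost, and if it returns a solution whenever an optimal one exists.  Without the last clause the
   algorithm that always fails would be optimal; without restricting it to the instances that
   have an optimal solution there would be no optimal algorithm at all. *)
definition optimal_algorithm ::
  "mamp set \<Rightarrow> (mamp \<Rightarrow> 's \<Rightarrow> bool) \<Rightarrow> (mamp \<Rightarrow> 's \<Rightarrow> real) \<Rightarrow> (mamp \<Rightarrow> 's option) \<Rightarrow> bool" where
  "optimal_algorithm C feasible cost A \<longleftrightarrow>
     (\<forall>I\<in>C. case A I of
        Some s \<Rightarrow> is_arg_min (cost I) (feasible I) s
      | None \<Rightarrow> \<not> (\<exists>s. is_arg_min (cost I) (feasible I) s))"

definition sa_solution :: "mamp \<Rightarrow> backward_solution \<Rightarrow> sim_solution" where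
  "sa_solution I r =
     (let tf = (MAX i\<in>{..<num_agents I}. duration (r i)) in
      \<lparr>final_time = tf,
       agent_state = (\<lambda>i t. if t \<ge> tf - duration (r i) then state (r i) (tf - t)
                            else init_state I i),
       agent_ctrl = (\<lambda>i t. if t \<ge> tf - duration (r i) then ctrl (r i) (tf - t)
                           else 0\<^sub>v (ctrl_dim I i))\<rparr>)"

definition SA :: "(mamp \<Rightarrow> backward_solution option) \<Rightarrow> mamp \<Rightarrow> sim_solution option" where
  "SA A I = map_option (sa_solution I) (A I)"

end

(* Reversing time turns a simultaneous-arrival solution with final time t_f into a backward
   solution in which every agent has duration t_f, and SA turns a backward solution into a
   simultaneous-arrival one with t_f the maximal duration: the wait prepended to the trajectory of
   an early agent merges with its own initial wait, and is free of collisions because the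
   backward problem keeps a finished agent at its initial state. Both maps preserve feasibility
   and cost, so minimizers correspond. *)
theory Submission
  imports Defs
begin

text \<open>With \<open>q\<close> of negative duration the two junctions would come in the wrong
  order and the case distinctions would differ.\<close>

lemma motion_append_assoc:
  assumes "duration q \<ge> 0"
  shows "motion_append (motion_append p q) r = motion_append p (motion_append q r)"
  using assms by (auto simp: motion_append_def fun_eq_iff algebra_simps)

text \<open>Serves to pull a prepended wait out of the left-nested concatenation in
  \<open>admissible\<close>. The accumulator \<open>q\<close> is generalized; nonnegative durations
  keep associativity available.\<close>

lemma foldl_motion_append:
  assumes "duration q \<ge> 0" "\<forall>p\<in>set ps. duration p \<ge> 0"
  shows "foldl motion_append (motion_append p q) ps = motion_append p (foldl motion_append q ps)"
  using assms
proof (induction ps arbitrary: q)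
  case (Cons a ps)
  then have "duration (motion_append q a) \<ge> 0"
    by (simp add: motion_append_def)
  with Cons show ?case
    by (simp add: motion_append_assoc)
qed simp

lemma motion_append_wait_wait:
  "\<tau> \<ge> 0 \<Longrightarrow> motion_append (wait I i \<delta>) (wait I i \<tau>) = wait I i (\<delta> + \<tau>)"
  by (simp add: motion_append_def wait_def fun_eq_iff)

text \<open>A wait is constant, so its end state is the initial state whatever its duration.\<close>

lemma successively_matching_wait:
  "successively matching (wait I i \<tau> # ps) \<longleftrightarrow> successively matching (wait I i \<sigma> # ps)"
  by (cases ps) (auto simp: matching_def wait_def)

text \<open>The second motion is only read at times shifted into its own interval, where
  \<open>m\<close> and \<open>n\<close> agree.\<close>

lemma same_motion_append:
  assumes "same_motion m n"
  shows "same_motion (motion_append p m) (motion_append p n)"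
  using assms by (auto simp: same_motion_def motion_append_def)

lemma same_motion_trans:
  "same_motion p q \<Longrightarrow> same_motion q r \<Longrightarrow> same_motion p r"
  by (auto simp: same_motion_def)

lemma admissible_same_motion:
  "admissible I i m \<Longrightarrow> same_motion n m \<Longrightarrow> admissible I i n"
  unfolding admissible_def by (meson same_motion_trans)

text \<open>Reassociating puts the new wait next to the initial wait of \<open>m\<close>; the two
  fuse into one of duration \<open>\<delta> + \<tau>\<close>, followed by the same
  primitives.\<close>

lemma admissible_wait_append:
  assumes "admissible I i m" "\<delta> \<ge> 0" "\<forall>p\<in>primitives I i. duration p \<ge> 0"
  shows "admissible I i (motion_append (wait I i \<delta>) m)"
proof -
  from assms(1) obtain \<tau> ps where \<tau>: "\<tau> \<ge> 0" and ps: "set ps \<subseteq> primitives I i"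
    and match: "successively matching (wait I i \<tau> # ps)"
    and m: "same_motion m (foldl motion_append (wait I i \<tau>) ps)"
    by (auto simp: admissible_def)
  have "duration (wait I i \<tau>) \<ge> 0"
    using \<tau> by (simp add: wait_def)
  moreover have "\<forall>p\<in>set ps. duration p \<ge> 0"
    using ps assms(3) by blast
  ultimately have "motion_append (wait I i \<delta>) (foldl motion_append (wait I i \<tau>) ps)
      = foldl motion_append (wait I i (\<delta> + \<tau>)) ps"
    by (simp add: foldl_motion_append[symmetric] motion_append_wait_wait \<tau>)
  with same_motion_append[OF m]
  have "same_motion (motion_append (wait I i \<delta>) m)
      (foldl motion_append (wait I i (\<delta> + \<tau>)) ps)"
    by metis
  moreover have "successively matching (wait I i (\<delta> + \<tau>) # ps)"
    using match successively_matching_wait by blast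
  ultimately show ?thesis
    unfolding admissible_def using ps assms(2) \<tau> by (meson add_nonneg_nonneg)
qed

text \<open>The two case distinctions coincide, since \<open>tf - t\<close> is at most the duration
  exactly when \<open>t\<close> is at least \<open>tf\<close> minus the duration. State conditions
  can thus be read off the backward solution at reversed time.\<close>

lemma agent_state_sa_solution:
  "agent_state (sa_solution I r) i t
     = extended_state I i (r i) (final_time (sa_solution I r) - t)"
  by (auto simp: sa_solution_def extended_state_def Let_def)

lemma duration_le_final_time:
  "i < num_agents I \<Longrightarrow> duration (r i) \<le> final_time (sa_solution I r)"
  by (simp add: sa_solution_def Let_def)

text \<open>Multiplication by a positive constant is monotone, hence commutes with the maximum over
  the nonempty set of agents.\<close>

lemma sim_cost_sa_solution:
  assumes "num_agents I \<ge> 1" "c > 0"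
  shows "sim_cost c I (sa_solution I r) = backward_cost c I r"
proof -
  have "mono ((*) c)"
    using assms(2) by (simp add: mono_def)
  then have "c * Max ((\<lambda>i. duration (r i)) ` {..<num_agents I})
      = Max ((*) c ` (\<lambda>i. duration (r i)) ` {..<num_agents I})"
    by (rule mono_Max_commute) (use assms(1) in \<open>auto simp: lessThan_empty_iff bot_nat_def\<close>)
  then show ?thesis
    by (simp add: sim_cost_def backward_cost_def sa_solution_def Let_def image_image)
qed

lemma admissible_sa_solution:
  assumes "valid_instance I" "i < num_agents I"
    and "admissible I i m" "same_motion (r i) (time_reversal m)"
  shows "admissible I i \<lparr>duration = final_time (sa_solution I r),
    state = agent_state (sa_solution I r) i, ctrl = agent_ctrl (sa_solution I r) i\<rparr>"
proof (rule admissible_same_motion)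
  define \<delta> where "\<delta> = final_time (sa_solution I r) - duration (r i)"
  have "\<delta> \<ge> 0"
    using duration_le_final_time[OF assms(2)] by (simp add: \<delta>_def)
  then show "admissible I i (motion_append (wait I i \<delta>) m)"
    using assms by (intro admissible_wait_append) (auto simp: valid_instance_def)
  have dur: "duration m = duration (r i)"
    and rev: "\<And>t. 0 \<le> t \<Longrightarrow> t \<le> duration (r i) \<Longrightarrow>
      state (r i) t = state m (duration (r i) - t) \<and> ctrl (r i) t = ctrl m (duration (r i) - t)"
    using assms(4) by (auto simp: same_motion_def time_reversal_def)
  define T where "T = final_time (sa_solution I r)"
  have T: "(MAX i\<in>{..<num_agents I}. duration (r i)) = T"
    by (simp add: T_def sa_solution_def Let_def)
  \<comment> \<open>Reversing twice leaves a pure delay: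
    \<open>duration (r i) - (T - t) = t - \<delta>\<close>.\<close>
  have shift: "state (r i) (T - t) = state m (t - \<delta>) \<and> ctrl (r i) (T - t) = ctrl m (t - \<delta>)"
    if "t \<ge> \<delta>" "t \<le> T" for t
    using rev[of "T - t"] that by (simp add: \<delta>_def T_def algebra_simps)
  \<comment> \<open>At \<open>t = \<delta>\<close> both sides take the branch after the wait, so the
    controls agree at the junction too.\<close>
  show "same_motion \<lparr>duration = final_time (sa_solution I r),
      state = agent_state (sa_solution I r) i, ctrl = agent_ctrl (sa_solution I r) i\<rparr>
      (motion_append (wait I i \<delta>) m)"
    using shift \<delta>_def[folded T_def]
    by (auto simp: same_motion_def motion_append_def wait_def sa_solution_def T dur)
qed

lemma sim_feasible_sa_solution:
  assumes "valid_instance I" "backward_feasible I r"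
  shows "sim_feasible I (sa_solution I r)"
proof -
  define T where "T = final_time (sa_solution I r)"
  have dur: "0 \<le> duration (r i)" "duration (r i) \<le> T" if "i < num_agents I" for i
    using assms(2) duration_le_final_time[OF that] that
    by (auto simp: backward_feasible_def T_def)
  have "0 < num_agents I"
    using assms(1) by (simp add: valid_instance_def)
  from dur[OF this] have "T \<ge> 0"
    by linarith
  have ends: "state (r i) 0 = final_state I i" "state (r i) (duration (r i)) = init_state I i"
    and free: "\<And>t. 0 \<le> t \<Longrightarrow> t \<le> duration (r i) \<Longrightarrow> state (r i) t \<in> free_space I i"
    if "i < num_agents I" for i
    using assms(2) that by (auto simp: backward_feasible_def)
  have "admissible I i \<lparr>duration = T,
      state = agent_state (sa_solution I r) i, ctrl = agent_ctrl (sa_solution I r) i\<rparr>"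
    if "i < num_agents I" for i
    using assms that admissible_sa_solution unfolding backward_feasible_def T_def by blast
  moreover have "extended_state I i (r i) T = init_state I i" if "i < num_agents I" for i
    using dur[OF that] ends[OF that] by (auto simp: extended_state_def)
  moreover have "extended_state I i (r i) 0 = final_state I i" if "i < num_agents I" for i
    using dur[OF that] ends[OF that] by (auto simp: extended_state_def)
  \<comment> \<open>Beyond its duration the agent sits at its initial state, which is free as the
    last state of its backward motion.\<close>
  moreover have "extended_state I i (r i) t \<in> free_space I i" if "i < num_agents I" "t \<ge> 0" for i t
    using dur[OF that(1)] ends[OF that(1)] free[OF that(1)] that(2)
    by (metis extended_state_def order_refl)
  moreover have "region I i (extended_state I i (r i) t) \<inter> region I j (extended_state I j (r j) t) = {}"
    if "i < num_agents I" "j < num_agents I" "i \<noteq> j" "t \<ge> 0" for i j t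
    using assms(2) that by (auto simp: backward_feasible_def)
  ultimately show ?thesis
    using \<open>T \<ge> 0\<close> by (simp add: sim_feasible_def agent_state_sa_solution flip: T_def)
qed

text \<open>Initial waits stay part of the reversed motions, so that all agents get the same
  duration.\<close>

definition backward_of :: "sim_solution \<Rightarrow> backward_solution" where
  "backward_of s i = time_reversal
     \<lparr>duration = final_time s, state = agent_state s i, ctrl = agent_ctrl s i\<rparr>"

lemma backward_of_simps:
  "duration (backward_of s i) = final_time s"
  "state (backward_of s i) t = agent_state s i (final_time s - t)"
  by (simp_all add: backward_of_def time_reversal_def)

lemma backward_cost_backward_of:
  assumes "num_agents I \<ge> 1"
  shows "backward_cost c I (backward_of s) = sim_cost c I s"
proof -
  have "{..<num_agents I} \<noteq> {}"
    using assms by (auto simp: lessThan_empty_iff bot_nat_def)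
  then show ?thesis
    by (simp add: backward_cost_def sim_cost_def backward_of_simps)
qed

lemma backward_feasible_backward_of:
  assumes "sim_feasible I s"
  shows "backward_feasible I (backward_of s)"
proof -
  have T: "final_time s \<ge> 0"
    using assms by (simp add: sim_feasible_def)
  have init: "agent_state s i 0 = init_state I i" if "i < num_agents I" for i
    using assms that by (simp add: sim_feasible_def)
  \<comment> \<open>After the final time the extension freezes all agents in their configuration at
    forward time 0, so every backward time corresponds to a forward time in the interval.\<close>
  have ext: "extended_state I i (backward_of s i) t
      = agent_state s i (max 0 (final_time s - t))" if "i < num_agents I" for i t
    using init[OF that] by (auto simp: extended_state_def backward_of_simps max_def)
  have "\<exists>m. admissible I i m \<and> same_motion (backward_of s i) (time_reversal m)"
    if "i < num_agents I" for i
    using assms that unfolding sim_feasible_def backward_of_def same_motion_def by blast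
  moreover have "region I i (extended_state I i (backward_of s i) t) \<inter>
      region I j (extended_state I j (backward_of s j) t) = {}"
    if "i < num_agents I" "j < num_agents I" "i \<noteq> j" "t \<ge> 0" for i j t
    using assms that T unfolding ext[OF that(1)] ext[OF that(2)] by (simp add: sim_feasible_def)
  ultimately show ?thesis
    using assms T by (simp add: backward_feasible_def backward_of_simps sim_feasible_def)
qed

text \<open>A cheaper \<open>y\<close> satisfying \<open>Q\<close> would be carried by
  \<open>k\<close> to a point cheaper than \<open>x\<close>. The maps need not be inverse to each
  other.\<close>

lemma is_arg_min_transfer:
  assumes "is_arg_min f P x"
    and "\<And>x. P x \<Longrightarrow> Q (h x) \<and> g (h x) = f x"
    and "\<And>y. Q y \<Longrightarrow> P (k y) \<and> f (k y) = g y"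
  shows "is_arg_min g Q (h x)"
  using assms unfolding is_arg_min_def by metis

theorem theorem4:
  fixes c :: real
    and \<I> :: "mamp set"
    and A :: "mamp \<Rightarrow> backward_solution option"
  assumes "c > 0"
    and "\<forall>I\<in>\<I>. valid_instance I"
    and "optimal_algorithm \<I> backward_feasible (backward_cost c) A"
  shows "optimal_algorithm {I \<in> \<I>. at_rest I} sim_feasible (sim_cost c) (SA A)"
  unfolding optimal_algorithm_def
proof
  fix I assume "I \<in> {I \<in> \<I>. at_rest I}"
  then have "I \<in> \<I>" by simp
  with assms have valid: "valid_instance I"
    and A: "case A I of Some r \<Rightarrow> is_arg_min (backward_cost c I) (backward_feasible I) r
      | None \<Rightarrow> \<not> (\<exists>r. is_arg_min (backward_cost c I) (backward_feasible I) r)"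
    by (auto simp: optimal_algorithm_def)
  from valid have "num_agents I \<ge> 1"
    by (simp add: valid_instance_def)
  then have forward: "sim_feasible I (sa_solution I r)
      \<and> sim_cost c I (sa_solution I r) = backward_cost c I r" if "backward_feasible I r" for r
    using sim_feasible_sa_solution[OF valid that] sim_cost_sa_solution assms(1) by blast
  have backward: "backward_feasible I (backward_of s)
      \<and> backward_cost c I (backward_of s) = sim_cost c I s" if "sim_feasible I s" for s
    using backward_feasible_backward_of[OF that] backward_cost_backward_of \<open>num_agents I \<ge> 1\<close>
    by blast
  have "is_arg_min (sim_cost c I) (sim_feasible I) (sa_solution I r)"
    if "is_arg_min (backward_cost c I) (backward_feasible I) r" for r
    using is_arg_min_transfer[of _ _ r _ "sa_solution I" _ backward_of] that forward backward by blast
  \<comment> \<open>This direction settles the case \<open>None\<close>: an optimal simultaneous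
    solution would yield an optimal backward one, which \<open>A\<close> reports not to
    exist.\<close>
  moreover have "is_arg_min (backward_cost c I) (backward_feasible I) (backward_of s)"
    if "is_arg_min (sim_cost c I) (sim_feasible I) s" for s
    using is_arg_min_transfer[of _ _ s _ backward_of _ "sa_solution I"] that backward forward by blast
  ultimately show "case SA A I of Some s \<Rightarrow> is_arg_min (sim_cost c I) (sim_feasible I) s
      | None \<Rightarrow> \<not> (\<exists>s. is_arg_min (sim_cost c I) (sim_feasible I) s)"
    using A by (cases "A I") (auto simp: SA_def)
qed

end
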